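(* The following two statements are equivalent: (i) For any two Gallai-Ramsey configurations $K_1$ and $K_2$, the Cartesian product $K_1\ast K_2$ is Gallai-Ramsey. (ii) Every Gallai-Ramsey configuration is Ramsey.
   Context: A configuration is a finite nonempty set of points in some Euclidean space $\mathbb{E}^m$. For $K_1\subset\mathbb{E}^{m_1}$, $K_2\subset\mathbb{E}^{m_2}$, the Cartesian product is $K_1\ast K_2=\{(x_1,\dots,x_{m_1},y_1,\dots,y_{m_2}):(x_i)\in K_1,(y_j)\in K_2\}\subset\mathbb{E}^{m_1+m_2}$. A configuration $K$ is Ramsey if for every positive integer $r$ there is $d$ such that every coloring of $\mathbb{E}^d$ with $r$ colors contains a monochromatic configuration congruent to $K$. A configuration $K$ is Gallai-Ramsey if for every positive integer $r$ there is $d$ such that every coloring of $\mathbb{E}^d$ with $r$ colors contains a configuration congruent to $K$ that is either monochromatic (all points the same color) or rainbow (all points pairwise distinct colors). *)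

theory Defs
  imports "HOL-Analysis.L2_Norm"
begin

text \<open>
  The dimension is quantified inside the statements below, so a point of Euclidean \<open>d\<close>-space
  is represented by the list of its \<open>d\<close> coordinates.
\<close>

definition euclid :: "nat \<Rightarrow> real list set" where
  "euclid d = {x. length x = d}"

text \<open>Only meaningful for two points of the same space, i.e. lists of equal length.\<close>

definition euclid_dist :: "real list \<Rightarrow> real list \<Rightarrow> real" where
  "euclid_dist x y = L2_set (\<lambda>i. x ! i - y ! i) {..<length x}"

definition configuration :: "real list set \<Rightarrow> bool" where
  "configuration K \<longleftrightarrow> finite K \<and> K \<noteq> {} \<and> (\<exists>m. K \<subseteq> euclid m)"

text \<open>The two sets may lie in Euclidean spaces of different dimensions.\<close>

definition congruent_conf :: "real list set \<Rightarrow> real list set \<Rightarrow> bool" where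
  "congruent_conf K L \<longleftrightarrow>
     (\<exists>f. bij_betw f K L \<and> (\<forall>x\<in>K. \<forall>y\<in>K. euclid_dist (f x) (f y) = euclid_dist x y))"

definition cart_prod :: "real list set \<Rightarrow> real list set \<Rightarrow> real list set" where
  "cart_prod K\<^sub>1 K\<^sub>2 = {x @ y | x y. x \<in> K\<^sub>1 \<and> y \<in> K\<^sub>2}"

definition coloring :: "nat \<Rightarrow> nat \<Rightarrow> (real list \<Rightarrow> nat) \<Rightarrow> bool" where
  "coloring d r c \<longleftrightarrow> (\<forall>x\<in>euclid d. c x < r)"

definition monochromatic :: "(real list \<Rightarrow> nat) \<Rightarrow> real list set \<Rightarrow> bool" where
  "monochromatic c K \<longleftrightarrow> (\<forall>x\<in>K. \<forall>y\<in>K. c x = c y)"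

definition rainbow :: "(real list \<Rightarrow> nat) \<Rightarrow> real list set \<Rightarrow> bool" where
  "rainbow c K \<longleftrightarrow> (\<forall>x\<in>K. \<forall>y\<in>K. x \<noteq> y \<longrightarrow> c x \<noteq> c y)"

definition ramsey :: "real list set \<Rightarrow> bool" where
  "ramsey K \<longleftrightarrow> configuration K \<and>
     (\<forall>r\<ge>1. \<exists>d. \<forall>c. coloring d r c \<longrightarrow>
        (\<exists>L\<subseteq>euclid d. congruent_conf K L \<and> monochromatic c L))"

definition gallai_ramsey :: "real list set \<Rightarrow> bool" where
  "gallai_ramsey K \<longleftrightarrow> configuration K \<and>
     (\<forall>r\<ge>1. \<exists>d. \<forall>c. coloring d r c \<longrightarrow>
        (\<exists>L\<subseteq>euclid d. congruent_conf K L \<and> (monochromatic c L \<or> rainbow c L)))"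

end

theory Submission
  imports Defs "HOL-Analysis.Product_Topology"
begin

text \<open>
  If products preserve the Gallai-Ramsey property and \<open>K\<close> is Gallai-Ramsey with at least two
  points, then for every \<open>r\<close> some iterated product of \<open>K\<close> has more than \<open>r\<close> points. It has no
  rainbow copy in an \<open>r\<close>-coloring, so it has a monochromatic one, and a slice of that copy is a
  monochromatic copy of \<open>K\<close>.

  Conversely it suffices that products of Ramsey configurations are Ramsey. By compactness, finitely
  many copies of \<open>K\<^sub>1\<close> already force a monochromatic one in every \<open>r\<close>-coloring of \<open>E\<^sup>d\<close>. Let \<open>T\<close> be
  their union, and color the points \<open>y\<close> of a second space by the functions \<open>x \<mapsto> c (x, y)\<close> on \<open>T\<close>.
  These are finitely many colors, so there is a copy of \<open>K\<^sub>2\<close> on which \<open>c (x, y)\<close>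
  depends on \<open>x \<in> T\<close> only.
\<close>

section \<open>Compactness for colorings\<close>

lemma monochromatic_iff: "monochromatic c K \<longleftrightarrow> (\<exists>k. \<forall>x\<in>K. c x = k)"
  unfolding monochromatic_def by metis

text \<open>The colorings of \<open>V\<close> with \<open>r\<close> colors form a product of finite
  discrete spaces, which is compact by Tychonoff. Being constant on a finite set is an open
  condition, so these conditions form an open cover indexed by the family, and a finite subcover
  gives the subfamily.\<close>

lemma finite_subfamily_monochromatic:
  fixes V :: "real list set"
  assumes fin: "\<And>E. E \<in> \<E> \<Longrightarrow> finite E"
    and sub: "\<And>E. E \<in> \<E> \<Longrightarrow> E \<subseteq> V"
    and mono: "\<And>c. \<forall>x\<in>V. c x < r \<Longrightarrow> \<exists>E\<in>\<E>. monochromatic c E"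
  shows "\<exists>\<F>\<subseteq>\<E>. finite \<F> \<and> (\<forall>c. (\<forall>x\<in>V. c x < r) \<longrightarrow> (\<exists>E\<in>\<F>. monochromatic c E))"
proof -
  define X where "X = product_topology (\<lambda>_. discrete_topology {..<r}) V"
  define U where "U E = {c \<in> topspace X. monochromatic c E}" for E
  have top: "topspace X = (\<Pi>\<^sub>E x\<in>V. {..<r})"
    by (simp add: X_def)
  have "compact_space X"
    by (simp add: X_def compact_space_product_topology compact_space_discrete_topology)
  moreover have "openin X (U E)" if E: "E \<in> \<E>" for E
  proof -
    have cont: "continuous_map X (discrete_topology {..<r}) (\<lambda>c. c x)" if "x \<in> V" for x
      unfolding X_def by (rule continuous_map_product_projection[OF that])
    have single: "openin X {c \<in> topspace X. c x = k}" if "x \<in> V" for x k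
    proof (cases "k < r")
      case True
      then show ?thesis
        using openin_continuous_map_preimage[OF cont[OF that], of "{k}"] by simp
    next
      case False
      then have "{c \<in> topspace X. c x = k} = {}"
        using that by (auto simp: top PiE_iff)
      then show ?thesis by (simp only: openin_empty)
    qed
    \<comment> \<open>Finiteness of \<open>E\<close> enters here: only finitely many coordinates are
      prescribed, so the intersection is a finite one.\<close>
    have const: "openin X {c \<in> topspace X. \<forall>x\<in>E. c x = k}" for k
    proof (cases "E = {}")
      case False
      then have "{c \<in> topspace X. \<forall>x\<in>E. c x = k} = (\<Inter>x\<in>E. {c \<in> topspace X. c x = k})"
        by auto
      also have "openin X \<dots>"
        using False fin[OF E] sub[OF E] single by (intro openin_Inter) auto
      finally show ?thesis .
    qed simp
    have "U E = (\<Union>k. {c \<in> topspace X. \<forall>x\<in>E. c x = k})"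
      by (auto simp: U_def monochromatic_iff)
    also have "openin X \<dots>"
      using const by (intro openin_Union) auto
    finally show ?thesis .
  qed
  moreover have "topspace X \<subseteq> \<Union> (U ` \<E>)"
  proof
    fix c
    assume c: "c \<in> topspace X"
    then obtain E where "E \<in> \<E>" "monochromatic c E"
      using mono[of c] by (auto simp: top PiE_iff)
    with c show "c \<in> \<Union> (U ` \<E>)"
      by (auto simp: U_def)
  qed
  ultimately obtain \<G> where "finite \<G>" "\<G> \<subseteq> U ` \<E>" and cover: "topspace X \<subseteq> \<Union>\<G>"
    unfolding compact_space_alt by (metis (no_types, lifting) imageE)
  then obtain \<F> where \<F>: "\<F> \<subseteq> \<E>" "finite \<F>" "\<G> = U ` \<F>"
    by (meson finite_subset_image)
  have "\<exists>E\<in>\<F>. monochromatic c E" if c: "\<forall>x\<in>V. c x < r" for c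
  proof -
    \<comment> \<open>Points of the product space are undefined outside \<open>V\<close>, so
      \<open>c\<close> is restricted first. Its values on \<open>E\<close> survive because
      \<open>E\<close> lies inside \<open>V\<close>.\<close>
    have "restrict c V \<in> topspace X"
      using c by (auto simp: top)
    then obtain E where "E \<in> \<F>" "monochromatic (restrict c V) E"
      using cover \<F>(3) by (auto simp: U_def)
    moreover have "E \<subseteq> V"
      using \<open>E \<in> \<F>\<close> \<F>(1) sub by blast
    ultimately show ?thesis
      by (intro bexI[of _ E]) (auto simp: monochromatic_iff subset_iff)
  qed
  then show ?thesis
    using \<F> by blast
qed

section \<open>Geometry of Cartesian products\<close>

text \<open>Pythagoras: the sum of squares splits at index \<open>length x\<close>.\<close>

lemma euclid_dist_append:
  assumes "length x = length x'" "length y = length y'"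
  shows "euclid_dist (x @ y) (x' @ y') = sqrt ((euclid_dist x x')\<^sup>2 + (euclid_dist y y')\<^sup>2)"
proof -
  have "sum f {..<length x + n} = sum f {..<length x} + (\<Sum>i<n. f (length x + i))"
    for f :: "nat \<Rightarrow> real" and n
    by (induction n) (simp_all add: add.assoc)
  then show ?thesis
    using assms by (simp add: euclid_dist_def L2_set_def nth_append sum_nonneg)
qed

lemma euclid_dist_append_same:
  assumes "length x = length x'"
  shows "euclid_dist (x @ y) (x' @ y) = euclid_dist x x'"
  using assms by (simp add: euclid_dist_append) (simp add: euclid_dist_def L2_set_def sum_nonneg)

lemma cart_prod_eq_image: "cart_prod K L = (\<lambda>(x, y). x @ y) ` (K \<times> L)"
  by (auto simp: cart_prod_def)

lemma inj_on_append: "K \<subseteq> euclid m \<Longrightarrow> inj_on (\<lambda>(x, y). x @ y) (K \<times> L)"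
  by (auto simp: inj_on_def euclid_def subset_iff)

lemma card_cart_prod: "configuration K \<Longrightarrow> card (cart_prod K L) = card K * card L"
  unfolding configuration_def cart_prod_eq_image
  by (auto simp: card_image inj_on_append card_cartesian_product)

lemma cart_prod_subset_euclid:
  "K \<subseteq> euclid m \<Longrightarrow> L \<subseteq> euclid n \<Longrightarrow> cart_prod K L \<subseteq> euclid (m + n)"
  by (auto simp: cart_prod_def euclid_def subset_iff)

lemma configuration_cart_prod:
  "configuration K \<Longrightarrow> configuration L \<Longrightarrow> configuration (cart_prod K L)"
  unfolding configuration_def
  by (intro conjI, simp add: cart_prod_eq_image, simp add: cart_prod_eq_image,
      meson cart_prod_subset_euclid)

text \<open>The two congruences act on separate blocks of coordinates, and by Pythagoras the
  distances in the blocks determine the distance in the product.\<close>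

lemma congruent_conf_cart_prod:
  assumes K: "K\<^sub>1 \<subseteq> euclid m\<^sub>1" "K\<^sub>2 \<subseteq> euclid m\<^sub>2"
    and L: "L\<^sub>1 \<subseteq> euclid d\<^sub>1" "L\<^sub>2 \<subseteq> euclid d\<^sub>2"
    and "congruent_conf K\<^sub>1 L\<^sub>1" "congruent_conf K\<^sub>2 L\<^sub>2"
  shows "congruent_conf (cart_prod K\<^sub>1 K\<^sub>2) (cart_prod L\<^sub>1 L\<^sub>2)"
proof -
  obtain f g where f: "bij_betw f K\<^sub>1 L\<^sub>1" "\<forall>x\<in>K\<^sub>1. \<forall>y\<in>K\<^sub>1. euclid_dist (f x) (f y) = euclid_dist x y"
    and g: "bij_betw g K\<^sub>2 L\<^sub>2" "\<forall>x\<in>K\<^sub>2. \<forall>y\<in>K\<^sub>2. euclid_dist (g x) (g y) = euclid_dist x y"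
    using assms by (auto simp: congruent_conf_def)
  \<comment> \<open>All points of \<open>K\<^sub>1\<close> have length \<open>m\<^sub>1\<close>, so
    cutting there recovers both factors.\<close>
  define h where "h z = f (take m\<^sub>1 z) @ g (drop m\<^sub>1 z)" for z
  have h: "h (x @ y) = f x @ g y" if "x \<in> K\<^sub>1" for x y
    using that K by (auto simp: h_def euclid_def)
  have len: "length (f x) = d\<^sub>1" "length x = m\<^sub>1" if "x \<in> K\<^sub>1" for x
    using that f(1) K L by (auto simp: euclid_def bij_betw_def)
  have len': "length (g x) = d\<^sub>2" "length x = m\<^sub>2" if "x \<in> K\<^sub>2" for x
    using that g(1) K L by (auto simp: euclid_def bij_betw_def)
  have "inj_on h (cart_prod K\<^sub>1 K\<^sub>2)"
    using f(1) g(1) by (auto simp: inj_on_def cart_prod_def h len bij_betw_def)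
  moreover have "h ` cart_prod K\<^sub>1 K\<^sub>2 = cart_prod L\<^sub>1 L\<^sub>2"
  proof -
    have "h ` cart_prod K\<^sub>1 K\<^sub>2 = cart_prod (f ` K\<^sub>1) (g ` K\<^sub>2)"
      by (force simp: cart_prod_eq_image h)
    then show ?thesis
      using f(1) g(1) by (simp add: bij_betw_def)
  qed
  moreover have "euclid_dist (h z) (h w) = euclid_dist z w"
    if "z \<in> cart_prod K\<^sub>1 K\<^sub>2" "w \<in> cart_prod K\<^sub>1 K\<^sub>2" for z w
    using that f(2) g(2) by (auto simp: cart_prod_def h len len' euclid_dist_append)
  ultimately show ?thesis
    unfolding congruent_conf_def bij_betw_def by blast
qed

text \<open>Appending a fixed \<open>y\<close> embeds \<open>K\<close> isometrically into the
  product; the given congruence then carries this slice into \<open>L\<close>.\<close>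

lemma congruent_conf_slice:
  assumes "K \<subseteq> euclid m" "y \<in> P" "congruent_conf (cart_prod K P) L"
  shows "\<exists>L'\<subseteq>L. congruent_conf K L'"
proof -
  obtain f where f: "bij_betw f (cart_prod K P) L"
      "\<forall>x\<in>cart_prod K P. \<forall>z\<in>cart_prod K P. euclid_dist (f x) (f z) = euclid_dist x z"
    using assms by (auto simp: congruent_conf_def)
  define g where "g x = f (x @ y)" for x
  have mem: "x @ y \<in> cart_prod K P" if "x \<in> K" for x
    using that assms by (auto simp: cart_prod_def)
  have "g ` K \<subseteq> L"
    using mem f(1) by (auto simp: g_def bij_betw_def)
  moreover have "bij_betw g K (g ` K)"
    using f(1) mem by (auto simp: bij_betw_def inj_on_def g_def)
  moreover have "euclid_dist (g x) (g z) = euclid_dist x z" if "x \<in> K" "z \<in> K" for x z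
    using that assms(1) f(2) mem by (auto simp: g_def euclid_dist_append_same euclid_def subset_iff)
  ultimately show ?thesis
    unfolding congruent_conf_def by blast
qed

section \<open>Products of Ramsey configurations\<close>

lemma ramsey_imp_gallai_ramsey: "ramsey K \<Longrightarrow> gallai_ramsey K"
  unfolding ramsey_def gallai_ramsey_def by meson

lemma ramsey_cart_prod:
  assumes "ramsey K\<^sub>1" "ramsey K\<^sub>2"
  shows "ramsey (cart_prod K\<^sub>1 K\<^sub>2)"
proof -
  obtain m\<^sub>1 m\<^sub>2 where K: "K\<^sub>1 \<subseteq> euclid m\<^sub>1" "K\<^sub>2 \<subseteq> euclid m\<^sub>2"
    and K_fin: "finite K\<^sub>1" and K_ne: "K\<^sub>2 \<noteq> {}"
    using assms by (auto simp: ramsey_def configuration_def)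
  have "\<exists>d. \<forall>c. coloring d r c \<longrightarrow>
      (\<exists>L\<subseteq>euclid d. congruent_conf (cart_prod K\<^sub>1 K\<^sub>2) L \<and> monochromatic c L)"
    if r: "r \<ge> 1" for r
  proof -
    obtain d\<^sub>1 where d\<^sub>1: "\<And>c. coloring d\<^sub>1 r c \<Longrightarrow>
        \<exists>L\<subseteq>euclid d\<^sub>1. congruent_conf K\<^sub>1 L \<and> monochromatic c L"
      using assms(1) r unfolding ramsey_def by meson
    define \<E> where "\<E> = {L. L \<subseteq> euclid d\<^sub>1 \<and> congruent_conf K\<^sub>1 L}"
    have \<E>_fin: "finite L" if "L \<in> \<E>" for L
      using that K_fin by (auto simp: \<E>_def congruent_conf_def dest: bij_betw_finite)
    obtain \<F> where \<F>: "\<F> \<subseteq> \<E>" "finite \<F>"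
      and mono\<F>: "\<And>c. coloring d\<^sub>1 r c \<Longrightarrow> \<exists>E\<in>\<F>. monochromatic c E"
      using finite_subfamily_monochromatic[of \<E> "euclid d\<^sub>1" r] \<E>_fin d\<^sub>1
      unfolding coloring_def \<E>_def by (smt (verit) mem_Collect_eq)
    define T where "T = \<Union>\<F>"
    have T: "finite T" "T \<subseteq> euclid d\<^sub>1"
      unfolding T_def using \<F> \<E>_fin by (blast, auto simp: \<E>_def)
    \<comment> \<open>The possible color patterns on \<open>T\<close>. There are finitely many
      because \<open>T\<close> is finite, and \<open>d\<^sub>2\<close> is chosen only after their
      number is known.\<close>
    define C where "C = (\<Pi>\<^sub>E x\<in>T. {..<r})"
    have C: "finite C" "C \<noteq> {}"
      using T r by (auto simp: C_def finite_PiE PiE_eq_empty_iff lessThan_empty_iff)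
    \<comment> \<open>Colors have to be numbers below a bound, so the patterns are numbered by
      \<open>e\<close>; its injectivity later turns equal numbers into equal patterns.\<close>
    obtain e where e: "bij_betw e C {..<card C}"
      using ex_bij_betw_finite_nat[OF C(1)] by (auto simp: atLeast0LessThan)
    have "card C \<ge> 1"
      using C by (simp add: Suc_le_eq card_gt_0_iff)
    then obtain d\<^sub>2 where d\<^sub>2: "\<And>c. coloring d\<^sub>2 (card C) c \<Longrightarrow>
        \<exists>L\<subseteq>euclid d\<^sub>2. congruent_conf K\<^sub>2 L \<and> monochromatic c L"
      using assms(2) unfolding ramsey_def by meson
    have "\<exists>L\<subseteq>euclid (d\<^sub>1 + d\<^sub>2). congruent_conf (cart_prod K\<^sub>1 K\<^sub>2) L \<and> monochromatic c L"
      if c: "coloring (d\<^sub>1 + d\<^sub>2) r c" for c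
    proof -
      define t where "t y = restrict (\<lambda>x. c (x @ y)) T" for y
      have bound: "c (x @ y) < r" if "x \<in> euclid d\<^sub>1" "y \<in> euclid d\<^sub>2" for x y
        using c that by (simp add: coloring_def euclid_def)
      have t: "t y \<in> C" if "y \<in> euclid d\<^sub>2" for y
        using bound that T(2) by (auto simp: t_def C_def)
      have "coloring d\<^sub>2 (card C) (e \<circ> t)"
        using bij_betwE[OF e] t by (simp add: coloring_def)
      then obtain L\<^sub>2 where L\<^sub>2: "L\<^sub>2 \<subseteq> euclid d\<^sub>2" "congruent_conf K\<^sub>2 L\<^sub>2" "monochromatic (e \<circ> t) L\<^sub>2"
        using d\<^sub>2 by blast
      obtain y\<^sub>0 where y\<^sub>0: "y\<^sub>0 \<in> L\<^sub>2"
        using L\<^sub>2(2) K_ne by (auto simp: congruent_conf_def bij_betw_def)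
      have "t y = t y\<^sub>0" if "y \<in> L\<^sub>2" for y
      proof -
        have "e (t y) = e (t y\<^sub>0)"
          using L\<^sub>2(3) that y\<^sub>0 by (auto simp: monochromatic_iff)
        then show ?thesis
          using e t L\<^sub>2(1) that y\<^sub>0 by (meson bij_betw_imp_inj_on inj_onD subsetD)
      qed
      then have slice: "c (x @ y) = c (x @ y\<^sub>0)" if "x \<in> T" "y \<in> L\<^sub>2" for x y
        using that unfolding t_def by (metis restrict_apply')
      \<comment> \<open>The slice at \<open>y\<^sub>0\<close> colors the whole first space, so some
        member of \<open>\<F>\<close> is monochromatic in it. That member lies in \<open>T\<close>,
        where every \<open>y\<close> in \<open>L\<^sub>2\<close> gives the same colors as
        \<open>y\<^sub>0\<close>.\<close>
      have "coloring d\<^sub>1 r (\<lambda>x. c (x @ y\<^sub>0))"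
        using bound y\<^sub>0 L\<^sub>2(1) by (auto simp: coloring_def)
      then obtain L\<^sub>1 where L\<^sub>1: "L\<^sub>1 \<in> \<F>" "monochromatic (\<lambda>x. c (x @ y\<^sub>0)) L\<^sub>1"
        using mono\<F> by blast
      have "L\<^sub>1 \<subseteq> euclid d\<^sub>1" "congruent_conf K\<^sub>1 L\<^sub>1" "L\<^sub>1 \<subseteq> T"
        using L\<^sub>1 \<F> by (auto simp: \<E>_def T_def)
      moreover from this have "monochromatic c (cart_prod L\<^sub>1 L\<^sub>2)"
        using L\<^sub>1(2) slice by (auto simp: monochromatic_iff cart_prod_def subset_iff)
      ultimately show ?thesis
        using cart_prod_subset_euclid[OF _ L\<^sub>2(1)]
          congruent_conf_cart_prod[OF K _ L\<^sub>2(1) _ L\<^sub>2(2)]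
        by (intro exI[of _ "cart_prod L\<^sub>1 L\<^sub>2"]) simp
    qed
    then show ?thesis by blast
  qed
  then show ?thesis
    using assms configuration_cart_prod by (simp add: ramsey_def)
qed

section \<open>From Gallai-Ramsey to Ramsey\<close>

text \<open>On a rainbow set the coloring is injective, so the pigeonhole principle excludes rainbow
  copies of large configurations.\<close>

lemma card_le_if_rainbow:
  assumes "coloring d r c" "L \<subseteq> euclid d" "rainbow c L"
  shows "card L \<le> r"
proof -
  have "inj_on c L" "c ` L \<subseteq> {..<r}"
    using assms by (auto simp: rainbow_def inj_on_def coloring_def)
  then show ?thesis
    using card_inj_on_le[of c L "{..<r}"] by simp
qed

lemma gallai_ramsey_imp_ramsey:
  assumes prod: "\<And>K\<^sub>1 K\<^sub>2. gallai_ramsey K\<^sub>1 \<Longrightarrow> gallai_ramsey K\<^sub>2 \<Longrightarrow> gallai_ramsey (cart_prod K\<^sub>1 K\<^sub>2)"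
    and K: "gallai_ramsey K"
  shows "ramsey K"
proof -
  have conf: "configuration K"
    using K by (simp add: gallai_ramsey_def)
  then obtain m where m: "finite K" "K \<noteq> {}" "K \<subseteq> euclid m"
    by (auto simp: configuration_def)
  have "\<exists>d. \<forall>c. coloring d r c \<longrightarrow> (\<exists>L\<subseteq>euclid d. congruent_conf K L \<and> monochromatic c L)"
    if r: "r \<ge> 1" for r
  proof (cases "card K \<ge> 2")
    case True
    \<comment> \<open>Each further factor \<open>K\<close> at least doubles the number of
      points.\<close>
    have "\<exists>P. gallai_ramsey P \<and> card P > n" for n
    proof (induction n)
      case 0
      show ?case using K True by (intro exI[of _ K]) auto
    next
      case (Suc n)
      then obtain P where P: "gallai_ramsey P" "card P > n" by blast
      have "Suc n < 2 * card P" using P(2) by simp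
      also have "\<dots> \<le> card (cart_prod K P)"
        using True conf by (simp add: card_cart_prod)
      finally show ?case using prod[OF K P(1)] by blast
    qed
    then obtain P where P: "gallai_ramsey P" "card P > r" by blast
    then obtain y where y: "y \<in> P" by fastforce
    \<comment> \<open>One more factor \<open>K\<close> is put in front of \<open>P\<close>, so that
      the slice over \<open>y\<close> is a copy of \<open>K\<close> itself; the number of points
      stays above \<open>r\<close>.\<close>
    have "r < card P" by (fact P(2))
    also have "\<dots> \<le> card (cart_prod K P)"
      using True conf by (simp add: card_cart_prod)
    finally have large: "r < card (cart_prod K P)" .
    obtain d where d: "\<And>c. coloring d r c \<Longrightarrow> \<exists>L\<subseteq>euclid d.
        congruent_conf (cart_prod K P) L \<and> (monochromatic c L \<or> rainbow c L)"
      using prod[OF K P(1)] r unfolding gallai_ramsey_def by meson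
    have "\<exists>L\<subseteq>euclid d. congruent_conf K L \<and> monochromatic c L" if c: "coloring d r c" for c
    proof -
      obtain L where L: "L \<subseteq> euclid d" "congruent_conf (cart_prod K P) L"
          "monochromatic c L \<or> rainbow c L"
        using d[OF c] by blast
      have "card L = card (cart_prod K P)"
        using L(2) bij_betw_same_card unfolding congruent_conf_def by metis
      then have "monochromatic c L"
        using card_le_if_rainbow[OF c L(1)] large L(3) by force
      moreover obtain L' where "L' \<subseteq> L" "congruent_conf K L'"
        using congruent_conf_slice[OF m(3) y L(2)] by blast
      ultimately show ?thesis
        using L(1) by (intro exI[of _ L']) (auto simp: monochromatic_iff subset_iff)
    qed
    then show ?thesis by blast
  \<comment> \<open>A single point does not grow under products, but it is trivially monochromatic,
    so \<open>K\<close> serves as its own copy in dimension \<open>m\<close>.\<close>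
  next
    case False
    moreover have "card K > 0"
      using m by (simp add: card_gt_0_iff)
    ultimately have "card K = 1" by linarith
    then obtain x where "K = {x}" by (auto simp: card_1_singleton_iff)
    then have "monochromatic c K" for c
      by (simp add: monochromatic_def)
    moreover have "congruent_conf K K"
      unfolding congruent_conf_def by (intro exI[of _ id]) auto
    ultimately show ?thesis using m(3) by blast
  qed
  then show ?thesis using conf by (simp add: ramsey_def)
qed

theorem theorem8:
  "(\<forall>K\<^sub>1 K\<^sub>2. gallai_ramsey K\<^sub>1 \<and> gallai_ramsey K\<^sub>2 \<longrightarrow> gallai_ramsey (cart_prod K\<^sub>1 K\<^sub>2))
   \<longleftrightarrow> (\<forall>K. gallai_ramsey K \<longrightarrow> ramsey K)"
proof (intro iffI allI impI)
  fix K
  assume "\<forall>K\<^sub>1 K\<^sub>2. gallai_ramsey K\<^sub>1 \<and> gallai_ramsey K\<^sub>2 \<longrightarrow> gallai_ramsey (cart_prod K\<^sub>1 K\<^sub>2)"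
    and "gallai_ramsey K"
  then show "ramsey K"
    by (intro gallai_ramsey_imp_ramsey) simp_all
next
  fix K\<^sub>1 K\<^sub>2
  assume "\<forall>K. gallai_ramsey K \<longrightarrow> ramsey K" and "gallai_ramsey K\<^sub>1 \<and> gallai_ramsey K\<^sub>2"
  then show "gallai_ramsey (cart_prod K\<^sub>1 K\<^sub>2)"
    by (intro ramsey_imp_gallai_ramsey ramsey_cart_prod) simp_all
qed

end
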